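(* For any integers $k\ge 1$ and $n\ge k+2$ there exist a variety $V\subseteq\mathbf{C}^{n-k}$ and a variety $U\subseteq\mathbf{C}^n$ such that $U$ is not a cylinder in $\mathbf{C}^n$, while $U$ and $V\times\mathbf{C}^k$ (both regarded as subvarieties of $\mathbf{C}^{2n}$ via $\mathbf{C}^n=\{x_{n+1}=\dots=x_{2n}=0\}$) are equivalent in $\mathbf{C}^{2n}$.
   Context: A variety $V(p_1,\dots,p_m)\subseteq\mathbf{C}^n$ is the affine variety defined by polynomials $p_i\in\mathbf{C}[x_1,\dots,x_n]$. Two varieties $V(p_1,\dots,p_m)$, $V(q_1,\dots,q_r)$ in $\mathbf{C}^n$ are equivalent if some automorphism of $\mathbf{C}[x_1,\dots,x_n]$ maps the ideal $\langle p_1,\dots,p_m\rangle$ onto $\langle q_1,\dots,q_r\rangle$. If $V=V(p_1,\dots,p_m)\subseteq\mathbf{C}^{n-k}$ with $p_i\in\mathbf{C}[x_1,\dots,x_{n-k}]$, then $V\times\mathbf{C}^k$ is the variety in $\mathbf{C}^n$ defined by the same polynomials. A cylinder in $\mathbf{C}^n$ is a variety equivalent in $\mathbf{C}^n$ to one of the form $W\times\mathbf{C}$ with $W\subseteq\mathbf{C}^{n-1}$. A variety $V(p_1,\dots,p_m)\subseteq\mathbf{C}^n$ is regarded in $\mathbf{C}^{2n}$ as $V(p_1,\dots,p_m,x_{n+1},\dots,x_{2n})$. *)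

theory Defs
  imports Complex_Main
begin

text \<open>Polynomials in C[x_1,...,x_n] are represented by the polynomial functions
  they induce (faithful since C is infinite). Points are maps nat => complex;
  variable x_(i+1) is coordinate i, so C[x_1..x_n] uses coordinates 0..n-1.\<close>

inductive_set poly_fun :: "nat \<Rightarrow> ((nat \<Rightarrow> complex) \<Rightarrow> complex) set" for n :: nat where
  const: "(\<lambda>_. c) \<in> poly_fun n"
| var: "i < n \<Longrightarrow> (\<lambda>x. x i) \<in> poly_fun n"
| add: "p \<in> poly_fun n \<Longrightarrow> q \<in> poly_fun n \<Longrightarrow> (\<lambda>x. p x + q x) \<in> poly_fun n"
| mult: "p \<in> poly_fun n \<Longrightarrow> q \<in> poly_fun n \<Longrightarrow> (\<lambda>x. p x * q x) \<in> poly_fun n"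

definition poly_ideal :: "nat \<Rightarrow> ((nat \<Rightarrow> complex) \<Rightarrow> complex) list \<Rightarrow> ((nat \<Rightarrow> complex) \<Rightarrow> complex) set" where
  "poly_ideal n ps = {f. \<exists>as. length as = length ps \<and> set as \<subseteq> poly_fun n \<and>
      f = (\<lambda>x. \<Sum>i<length ps. (as ! i) x * (ps ! i) x)}"

definition poly_aut :: "nat \<Rightarrow> (((nat \<Rightarrow> complex) \<Rightarrow> complex) \<Rightarrow> ((nat \<Rightarrow> complex) \<Rightarrow> complex)) \<Rightarrow> bool" where
  "poly_aut n \<sigma> \<longleftrightarrow> bij_betw \<sigma> (poly_fun n) (poly_fun n)
     \<and> (\<forall>c. \<sigma> (\<lambda>_. c) = (\<lambda>_. c))
     \<and> (\<forall>p\<in>poly_fun n. \<forall>q\<in>poly_fun n.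
          \<sigma> (\<lambda>x. p x + q x) = (\<lambda>x. \<sigma> p x + \<sigma> q x) \<and>
          \<sigma> (\<lambda>x. p x * q x) = (\<lambda>x. \<sigma> p x * \<sigma> q x))"

definition equivalent :: "nat \<Rightarrow> ((nat \<Rightarrow> complex) \<Rightarrow> complex) list \<Rightarrow> ((nat \<Rightarrow> complex) \<Rightarrow> complex) list \<Rightarrow> bool" where
  "equivalent n ps qs \<longleftrightarrow> set ps \<subseteq> poly_fun n \<and> set qs \<subseteq> poly_fun n \<and>
     (\<exists>\<sigma>. poly_aut n \<sigma> \<and> \<sigma> ` poly_ideal n ps = poly_ideal n qs)"

text \<open>V(ps) is a cylinder in C^n: equivalent to some W x C with W in C^(n-1).\<close>
definition is_cylinder :: "nat \<Rightarrow> ((nat \<Rightarrow> complex) \<Rightarrow> complex) list \<Rightarrow> bool" where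
  "is_cylinder n ps \<longleftrightarrow> (\<exists>qs. set qs \<subseteq> poly_fun (n - 1) \<and> equivalent n ps qs)"

text \<open>V(ps) in C^n regarded in C^(2n): add x_(n+1),...,x_(2n).\<close>
definition embed2 :: "nat \<Rightarrow> ((nat \<Rightarrow> complex) \<Rightarrow> complex) list \<Rightarrow> ((nat \<Rightarrow> complex) \<Rightarrow> complex) list" where
  "embed2 n ps = ps @ map (\<lambda>i. (\<lambda>x. x i)) [n..<2*n]"

end

theory Submission
  imports Defs "HOL-Computational_Algebra.Polynomial" "HOL-Analysis.Derivative"
begin

text \<open>Let \<open>f = x\<^sub>1x\<^sub>2 + x\<^sub>3\<^sup>2 + \<dots> + x\<^sub>n\<^sup>2\<close> and \<open>U = V(x\<^sub>1f - 1)\<close>, \<open>V = V(x\<^sub>1x\<^sub>2 - 1)\<close>.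
  On \<open>U\<close> the coordinate \<open>x\<^sub>1\<close> is invertible, so \<open>f\<close> and \<open>x\<^sub>2\<close> determine each other; with one
  extra coordinate at hand this exchange extends to an automorphism taking \<open>U\<close> to \<open>V \<times> C\<^sup>k\<close>.
  If \<open>U\<close> were a cylinder, then in suitable coordinates \<open>x\<^sub>1f - 1\<close> would not involve the last
  variable, and neither would \<open>f\<close>, being a factor of \<open>x\<^sub>1f\<close>. The critical locus of \<open>f\<close> would then
  be invariant under a nontrivial translation, but it consists of a single point.\<close>

section \<open>Polynomial functions\<close>

lemma poly_fun_uminus: "p \<in> poly_fun n \<Longrightarrow> (\<lambda>x. - p x) \<in> poly_fun n"
  using poly_fun.mult[OF poly_fun.const[of "-1"], of p n] by simp

lemma poly_fun_diff: "p \<in> poly_fun n \<Longrightarrow> q \<in> poly_fun n \<Longrightarrow> (\<lambda>x. p x - q x) \<in> poly_fun n"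
  using poly_fun.add[OF _ poly_fun_uminus, of p n q] by simp

lemma poly_fun_sum:
  "finite I \<Longrightarrow> (\<And>i. i \<in> I \<Longrightarrow> p i \<in> poly_fun n) \<Longrightarrow> (\<lambda>x. \<Sum>i\<in>I. p i x) \<in> poly_fun n"
  by (induction I rule: finite_induct) (auto intro: poly_fun.intros)

lemmas poly_fun_intros = poly_fun.intros poly_fun_uminus poly_fun_diff poly_fun_sum

lemma poly_fun_cong:
  assumes "p \<in> poly_fun n" and "\<And>i. i < n \<Longrightarrow> x i = y i"
  shows "p x = p y"
  using assms(1) by induction (use assms(2) in auto)

lemma poly_fun_compose:
  assumes "p \<in> poly_fun n" and "\<And>i. i < n \<Longrightarrow> (\<lambda>x. F x i) \<in> poly_fun m"
  shows "(\<lambda>x. p (F x)) \<in> poly_fun m"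
  using assms(1) by induction (use assms(2) in \<open>auto intro: poly_fun.intros\<close>)

text \<open>Restriction to a line gives a univariate polynomial, so degrees and cancellation become
  available.\<close>

lemma poly_fun_on_line:
  assumes "p \<in> poly_fun n"
  shows "\<exists>P. \<forall>s. p (\<lambda>i. u i + s * v i) = poly P s"
  using assms
proof induction
  case (const c)
  show ?case by (rule exI[of _ "[:c:]"]) simp
next
  case (var i)
  show ?case by (rule exI[of _ "[:u i, v i:]"]) simp
next
  case (add p q)
  then show ?case by (metis poly_add)
next
  case (mult p q)
  then show ?case by (metis poly_mult)
qed

lemma poly_fun_differentiable:
  assumes "p \<in> poly_fun n" and "\<And>i. i < n \<Longrightarrow> (\<lambda>s. g s i) field_differentiable (at z within S)"
  shows "(\<lambda>s. p (g s)) field_differentiable (at z within S)"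
  using assms(1)
  by induction (use assms(2) in \<open>auto intro: field_differentiable_add field_differentiable_mult\<close>)

text \<open>Expresses, for polynomials given as functions, that the variable with index
  \<open>j\<close> does not occur.\<close>

definition indep_of :: "nat \<Rightarrow> ((nat \<Rightarrow> complex) \<Rightarrow> complex) \<Rightarrow> bool" where
  "indep_of j p \<longleftrightarrow> (\<forall>x t. p (x(j := t)) = p x)"

lemma poly_fun_indep_of: "p \<in> poly_fun n \<Longrightarrow> n \<le> j \<Longrightarrow> indep_of j p"
  unfolding indep_of_def by (auto intro: poly_fun_cong)

text \<open>Degrees in one variable add over products, so a factor of a nonzero polynomial free of
  that variable is free of it too. This is argued on lines in direction \<open>j\<close> where the
  product does not vanish, then extended to all points by a density argument.\<close>

lemma indep_of_factor:
  assumes a: "a \<in> poly_fun n" and b: "b \<in> poly_fun n"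
    and ind: "indep_of j (\<lambda>x. a x * b x)" and nz: "a x0 * b x0 \<noteq> 0"
  shows "indep_of j a"
proof -
  have generic: "a (x(j := t)) = a x" if x: "a x * b x \<noteq> 0" for x t
  proof -
    let ?v = "\<lambda>i. if i = j then 1 else 0"
    obtain A B where A: "\<And>s. a (\<lambda>i. x i + s * ?v i) = poly A s"
      and B: "\<And>s. b (\<lambda>i. x i + s * ?v i) = poly B s"
      using poly_fun_on_line[OF a, of x ?v] poly_fun_on_line[OF b, of x ?v] by blast
    have line: "(\<lambda>i. x i + s * ?v i) = x(j := x j + s)" for s
      by (auto simp: fun_eq_iff)
    have "poly (A * B) s = a x * b x" for s
      using ind A[of s, symmetric] B[of s, symmetric] unfolding line indep_of_def by simp
    then have "A * B = [:a x * b x:]"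
      by (intro poly_ext) simp
    then have "A * B \<noteq> 0" "degree (A * B) = 0"
      using x by auto
    then have "degree A = 0"
      by (auto simp: degree_mult_eq)
    then obtain c where "A = [:c:]"
      by (rule degree_eq_zeroE)
    then have "a (x(j := x j + s)) = c" for s
      using A[of s] unfolding line by simp
    from this[of 0] this[of "t - x j"] show ?thesis by simp
  qed
  have "a (x(j := t)) = a x" for x t
  \<comment> \<open>The line from \<open>x\<close> to \<open>x0\<close> is compared with its copy
    whose coordinate \<open>j\<close> is frozen at \<open>t\<close>. The product is nonzero at
    \<open>x0\<close>, hence at all but finitely many points of the first line.\<close>
  proof -
    let ?v = "\<lambda>i. x0 i - x i"
    let ?l = "\<lambda>s i. x i + s * ?v i"
    let ?u' = "x(j := t)" and ?v' = "?v(j := 0)"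
    obtain A B A' where A: "\<And>s. a (?l s) = poly A s" and B: "\<And>s. b (?l s) = poly B s"
      and A': "\<And>s. a (\<lambda>i. ?u' i + s * ?v' i) = poly A' s"
      using poly_fun_on_line[OF a, of x ?v] poly_fun_on_line[OF b, of x ?v]
        poly_fun_on_line[OF a, of ?u' ?v'] by blast
    have line': "(\<lambda>i. ?u' i + s * ?v' i) = (?l s)(j := t)" for s
      by (auto simp: fun_eq_iff)
    have "poly (A * B) 1 \<noteq> 0"
      using nz A[of 1] B[of 1] by simp
    then have AB: "A * B \<noteq> 0" by auto
    \<comment> \<open>Where the product vanishes, \<open>generic\<close> gives nothing; the factor
      \<open>A * B\<close> covers those \<open>s\<close> and is cancelled afterwards.\<close>
    have "poly ((A' - A) * (A * B)) s = 0" for s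
      using generic[of "?l s" t] A[of s] B[of s] A'[of s] unfolding line' by (cases "poly (A * B) s = 0") auto
    then have "(A' - A) * (A * B) = 0"
      by (metis poly_0 poly_ext)
    with AB have "A' = A" by simp
    then show ?thesis
      using A[of 0] A'[of 0] by (simp add: fun_upd_def)
  qed
  then show ?thesis by (simp add: indep_of_def)
qed

section \<open>Ideals and automorphisms\<close>

lemma poly_ideal_zero: "(\<lambda>_. 0) \<in> poly_ideal n ps"
  unfolding poly_ideal_def
  by (intro CollectI exI[of _ "replicate (length ps) (\<lambda>_. 0)"]) (auto intro: poly_fun.const)

lemma poly_ideal_add:
  assumes "f \<in> poly_ideal n ps" and "g \<in> poly_ideal n ps"
  shows "(\<lambda>x. f x + g x) \<in> poly_ideal n ps"
proof -
  obtain as bs where as: "length as = length ps" "set as \<subseteq> poly_fun n"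
      "f = (\<lambda>x. \<Sum>i<length ps. (as ! i) x * (ps ! i) x)"
    and bs: "length bs = length ps" "set bs \<subseteq> poly_fun n"
      "g = (\<lambda>x. \<Sum>i<length ps. (bs ! i) x * (ps ! i) x)"
    using assms unfolding poly_ideal_def by blast
  let ?cs = "map2 (\<lambda>a b x. a x + b x) as bs"
  have "set ?cs \<subseteq> poly_fun n"
    using as(2) bs(2) by (auto intro!: poly_fun.add dest: set_zip_leftD set_zip_rightD)
  moreover have "(\<lambda>x. f x + g x) = (\<lambda>x. \<Sum>i<length ps. (?cs ! i) x * (ps ! i) x)"
    using as bs by (simp add: sum.distrib[symmetric] distrib_right)
  ultimately show ?thesis
    unfolding poly_ideal_def using as(1) bs(1) by (intro CollectI exI[of _ ?cs]) simp
qed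

lemma poly_ideal_mult:
  assumes "a \<in> poly_fun n" and "f \<in> poly_ideal n ps"
  shows "(\<lambda>x. a x * f x) \<in> poly_ideal n ps"
proof -
  obtain as where as: "length as = length ps" "set as \<subseteq> poly_fun n"
      "f = (\<lambda>x. \<Sum>i<length ps. (as ! i) x * (ps ! i) x)"
    using assms unfolding poly_ideal_def by blast
  let ?cs = "map (\<lambda>b x. a x * b x) as"
  have "set ?cs \<subseteq> poly_fun n"
    using as(2) assms(1) by (auto intro: poly_fun.mult)
  moreover have "(\<lambda>x. a x * f x) = (\<lambda>x. \<Sum>i<length ps. (?cs ! i) x * (ps ! i) x)"
    using as by (simp add: sum_distrib_left mult.assoc)
  ultimately show ?thesis
    unfolding poly_ideal_def using as(1) by (intro CollectI exI[of _ ?cs]) simp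
qed

lemma poly_ideal_generator:
  assumes "p \<in> set ps"
  shows "p \<in> poly_ideal n ps"
proof -
  obtain k where k: "k < length ps" "ps ! k = p"
    using assms by (auto simp: in_set_conv_nth)
  let ?as = "map (\<lambda>i _. if i = k then 1 else 0) [0..<length ps]"
  have "set ?as \<subseteq> poly_fun n"
    by (auto intro: poly_fun.const)
  moreover have "p = (\<lambda>x. \<Sum>i<length ps. (?as ! i) x * (ps ! i) x)"
  proof
    fix x
    have "(\<Sum>i<length ps. (?as ! i) x * (ps ! i) x) = (\<Sum>i<length ps. if i = k then p x else 0)"
      using k by (intro sum.cong) auto
    then show "p x = (\<Sum>i<length ps. (?as ! i) x * (ps ! i) x)"
      using k by simp
  qed
  ultimately show ?thesis
    unfolding poly_ideal_def by (intro CollectI exI[of _ ?as]) simp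
qed

lemma poly_ideal_sum:
  "finite I \<Longrightarrow> (\<And>i. i \<in> I \<Longrightarrow> f i \<in> poly_ideal n ps) \<Longrightarrow> (\<lambda>x. \<Sum>i\<in>I. f i x) \<in> poly_ideal n ps"
  by (induction I rule: finite_induct) (auto intro: poly_ideal_zero poly_ideal_add)

lemma poly_ideal_singletonE:
  assumes "f \<in> poly_ideal n [p]"
  obtains a where "a \<in> poly_fun n" and "f = (\<lambda>x. a x * p x)"
  using assms unfolding poly_ideal_def by (auto simp: length_Suc_conv)

lemma poly_ideal_compose:
  assumes f: "f \<in> poly_ideal n ps"
    and F: "\<And>i. i < n \<Longrightarrow> (\<lambda>x. F x i) \<in> poly_fun m"
    and gen: "\<And>p. p \<in> set ps \<Longrightarrow> (\<lambda>x. p (F x)) \<in> poly_ideal m qs"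
  shows "(\<lambda>x. f (F x)) \<in> poly_ideal m qs"
proof -
  obtain as where as: "length as = length ps" "set as \<subseteq> poly_fun n"
      "f = (\<lambda>x. \<Sum>i<length ps. (as ! i) x * (ps ! i) x)"
    using f unfolding poly_ideal_def by blast
  have "(\<lambda>x. (as ! i) (F x) * (ps ! i) (F x)) \<in> poly_ideal m qs" if "i < length ps" for i
  proof (rule poly_ideal_mult)
    have "as ! i \<in> poly_fun n"
      using that as(1,2) nth_mem[of i as] by auto
    then show "(\<lambda>x. (as ! i) (F x)) \<in> poly_fun m"
      by (rule poly_fun_compose) (rule F)
    show "(\<lambda>x. (ps ! i) (F x)) \<in> poly_ideal m qs"
      using that by (intro gen) simp
  qed
  then show ?thesis
    unfolding as(3) by (intro poly_ideal_sum) auto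
qed

text \<open>Composition with \<open>F\<close> is an automorphism with inverse composition with
  \<open>G\<close>, and each inclusion of ideals can be checked on generators.\<close>

lemma equivalentI:
  assumes F: "\<And>i. i < n \<Longrightarrow> (\<lambda>x. F x i) \<in> poly_fun n"
    and G: "\<And>i. i < n \<Longrightarrow> (\<lambda>x. G x i) \<in> poly_fun n"
    and FG: "\<And>x. F (G x) = x" and GF: "\<And>x. G (F x) = x"
    and ps: "set ps \<subseteq> poly_fun n" and qs: "set qs \<subseteq> poly_fun n"
    and psF: "\<And>p. p \<in> set ps \<Longrightarrow> (\<lambda>x. p (F x)) \<in> poly_ideal n qs"
    and qsG: "\<And>q. q \<in> set qs \<Longrightarrow> (\<lambda>x. q (G x)) \<in> poly_ideal n ps"
  shows "equivalent n ps qs"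
proof -
  let ?\<sigma> = "\<lambda>p x. p (F x)"
  have "bij_betw ?\<sigma> (poly_fun n) (poly_fun n)"
    by (rule bij_betw_byWitness[where f' = "\<lambda>p x. p (G x)"])
      (auto simp: FG GF intro: poly_fun_compose F G)
  then have "poly_aut n ?\<sigma>"
    unfolding poly_aut_def by auto
  moreover have "?\<sigma> ` poly_ideal n ps = poly_ideal n qs"
  proof (intro subset_antisym subsetI)
    fix g assume "g \<in> ?\<sigma> ` poly_ideal n ps"
    then show "g \<in> poly_ideal n qs"
      by (auto intro: poly_ideal_compose F psF)
  next
    fix g assume "g \<in> poly_ideal n qs"
    then have "(\<lambda>x. g (G x)) \<in> poly_ideal n ps"
      by (rule poly_ideal_compose) (rule G qsG, assumption)+
    then show "g \<in> ?\<sigma> ` poly_ideal n ps"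
      by (intro image_eqI[of _ _ "\<lambda>x. g (G x)"]) (simp_all add: GF)
  qed
  ultimately show ?thesis
    unfolding equivalent_def using ps qs by blast
qed

text \<open>A homomorphism fixing constants is substitution of the images of the variables. For
  \<open>i\<close> at least \<open>n\<close> these images are unspecified, but \<open>p\<close> does
  not see them.\<close>

lemma poly_aut_apply:
  assumes "poly_aut n \<sigma>" and "p \<in> poly_fun n"
  shows "\<sigma> p x = p (\<lambda>i. \<sigma> (\<lambda>y. y i) x)"
  using assms(2) by (induction) (use assms(1) in \<open>simp_all add: poly_aut_def\<close>)

lemma poly_aut_closed: "poly_aut n \<sigma> \<Longrightarrow> p \<in> poly_fun n \<Longrightarrow> \<sigma> p \<in> poly_fun n"
  unfolding poly_aut_def by (auto dest: bij_betw_apply)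

lemma poly_aut_inverse:
  assumes \<sigma>: "poly_aut n \<sigma>"
  obtains G where "\<And>i. i < n \<Longrightarrow> (\<lambda>x. G x i) \<in> poly_fun n"
    and "\<And>i x. i < n \<Longrightarrow> \<sigma> (\<lambda>y. y i) (G x) = x i"
    and "\<And>i x. i < n \<Longrightarrow> G (\<lambda>j. \<sigma> (\<lambda>y. y j) x) i = x i"
proof -
  have bij: "bij_betw \<sigma> (poly_fun n) (poly_fun n)"
    using \<sigma> by (simp add: poly_aut_def)
  define \<tau> where "\<tau> = inv_into (poly_fun n) \<sigma>"
  have \<tau>: "\<tau> p \<in> poly_fun n" "\<sigma> (\<tau> p) = p" if "p \<in> poly_fun n" for p
    using that bij unfolding \<tau>_def
    by (auto simp: bij_betw_def inv_into_into f_inv_into_f)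
  let ?G = "\<lambda>x i. \<tau> (\<lambda>y. y i) x"
  have G: "(\<lambda>x. ?G x i) \<in> poly_fun n" if "i < n" for i
    using \<tau>(1) that by (auto intro: poly_fun.var)
  have GF: "?G (\<lambda>j. \<sigma> (\<lambda>y. y j) x) i = x i" if "i < n" for i x
    using poly_aut_apply[OF \<sigma> \<tau>(1)[OF poly_fun.var[OF that]], of x]
      \<tau>(2)[OF poly_fun.var[OF that]] by simp
  have FG: "\<sigma> (\<lambda>y. y i) (?G x) = x i" if i: "i < n" for i x
  proof -
    let ?xi = "\<lambda>y :: nat \<Rightarrow> complex. y i"
    have xi: "?xi \<in> poly_fun n" using i by (rule poly_fun.var)
    let ?h = "\<lambda>x. \<sigma> ?xi (?G x)"
    \<comment> \<open>By \<open>GF\<close>, applying \<open>\<sigma>\<close> to \<open>?h\<close>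
      gives the same as applying it to the coordinate; injectivity then yields the other
      composition.\<close>
    have h: "?h \<in> poly_fun n"
      by (intro poly_fun_compose[OF poly_aut_closed[OF \<sigma> xi]] G)
    have "\<sigma> ?h x = \<sigma> ?xi x" for x
      using poly_aut_apply[OF \<sigma> h, of x]
        poly_fun_cong[OF poly_aut_closed[OF \<sigma> xi], of "?G (\<lambda>j. \<sigma> (\<lambda>y. y j) x)" x] GF
      by simp
    then have "\<sigma> ?h = \<sigma> ?xi" by blast
    then have "?h = ?xi"
      using bij h xi by (auto simp: bij_betw_def inj_on_def)
    then show ?thesis by meson
  qed
  show thesis
    by (rule that[OF G FG GF])
qed

section \<open>The quadratic form\<close>

definition sqsum :: "nat \<Rightarrow> (nat \<Rightarrow> complex) \<Rightarrow> complex" where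
  "sqsum n x = (\<Sum>i\<in>{2..<n}. x i * x i)"

definition qform :: "nat \<Rightarrow> (nat \<Rightarrow> complex) \<Rightarrow> complex" where
  "qform n x = x 0 * x 1 + sqsum n x"

lemma sqsum_poly_fun: "n \<le> m \<Longrightarrow> sqsum n \<in> poly_fun m"
  unfolding sqsum_def[abs_def] by (intro poly_fun_intros) auto

lemma qform_poly_fun: "2 \<le> n \<Longrightarrow> n \<le> m \<Longrightarrow> qform n \<in> poly_fun m"
  unfolding qform_def[abs_def] by (intro poly_fun_intros sqsum_poly_fun) auto

text \<open>Stated for curves, since it serves both straight lines and the bent curve \<delta> used
  below.\<close>

lemma qform_has_derivative:
  assumes "2 \<le> n" and "\<And>i. i < n \<Longrightarrow> ((\<lambda>s. g s i) has_field_derivative v i) (at s)"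
  shows "((\<lambda>s. qform n (g s)) has_field_derivative
    g s 0 * v 1 + g s 1 * v 0 + (\<Sum>i\<in>{2..<n}. 2 * g s i * v i)) (at s)"
proof -
  have "((\<lambda>s. g s 0 * g s 1 + (\<Sum>i\<in>{2..<n}. g s i * g s i)) has_field_derivative
     (v 0 * g s 1 + v 1 * g s 0) + (\<Sum>i\<in>{2..<n}. v i * g s i + v i * g s i)) (at s)"
    by (intro DERIV_add DERIV_sum DERIV_mult assms(2)) (use assms(1) in auto)
  then show ?thesis
    unfolding qform_def sqsum_def by (simp add: algebra_simps)
qed

text \<open>The form is nondegenerate: testing along unit vectors reads off every coordinate of
  \<open>w\<close>, with indices 0 and 1 exchanged.\<close>

lemma qform_critical_point:
  assumes n: "2 \<le> n"
    and crit: "\<And>v. ((\<lambda>s. qform n (\<lambda>i. w i + s * v i)) has_field_derivative 0) (at 0)"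
    and i: "i < n"
  shows "w i = 0"
proof -
  have eq: "w 0 * v 1 + w 1 * v 0 + (\<Sum>j\<in>{2..<n}. 2 * w j * v j) = 0" for v
  proof -
    have "((\<lambda>s. qform n (\<lambda>j. w j + s * v j)) has_field_derivative
        w 0 * v 1 + w 1 * v 0 + (\<Sum>j\<in>{2..<n}. 2 * w j * v j)) (at 0)"
    proof -
      have "((\<lambda>s. w i + s * v i) has_field_derivative v i) (at 0)" for i
        by (auto intro!: derivative_eq_intros)
      then show ?thesis
        using qform_has_derivative[OF n, of "\<lambda>s j. w j + s * v j" v 0] by simp
    qed
    with crit show ?thesis using DERIV_unique by blast
  qed
  consider "i = 0" | "i = 1" | "2 \<le> i" by linarith
  then show ?thesis
  proof cases
    case 1
    then show ?thesis using eq[of "\<lambda>j. if j = 1 then 1 else 0"] by simp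
  next
    case 2
    then show ?thesis using eq[of "\<lambda>j. if j = 0 then 1 else 0"] by simp
  next
    case 3
    have "(\<Sum>j\<in>{2..<n}. 2 * w j * (if j = i then 1 else 0)) = (\<Sum>j\<in>{2..<n}. if j = i then 2 * w i else 0)"
      by (intro sum.cong) auto
    then show ?thesis using 3 i eq[of "\<lambda>j. if j = i then 1 else 0"] by simp
  qed
qed

text \<open>With \<open>F\<close> and \<open>G\<close> the mutually inverse polynomial maps attached to \<open>\<sigma>\<close>, the form vanishes to
  second order at \<open>F a\<close>, where \<open>a = G 0\<close>, hence also at \<open>F a'\<close> for the translate \<open>a'\<close> of \<open>a\<close>.\<close>

lemma poly_aut_qform_not_indep:
  assumes n: "2 \<le> n" and j: "j < n" and \<sigma>: "poly_aut n \<sigma>"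
  shows "\<not> indep_of j (\<sigma> (qform n))"
proof
  assume ind: "indep_of j (\<sigma> (qform n))"
  define F where "F = (\<lambda>x i. \<sigma> (\<lambda>y. y i) x)"
  have F: "(\<lambda>x. F x i) \<in> poly_fun n" if "i < n" for i
    using poly_aut_closed[OF \<sigma> poly_fun.var[OF that]] by (simp add: F_def)
  obtain G where G: "\<And>i. i < n \<Longrightarrow> (\<lambda>x. G x i) \<in> poly_fun n"
    and FG: "\<And>i x. i < n \<Longrightarrow> F (G x) i = x i"
    and GF: "\<And>i x. i < n \<Longrightarrow> G (F x) i = x i"
    using poly_aut_inverse[OF \<sigma>] unfolding F_def by metis
  have q: "qform n \<in> poly_fun n" using n by (simp add: qform_poly_fun)
  have shift: "qform n (F (x(j := t))) = qform n (F x)" for x t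
    using ind poly_aut_apply[OF \<sigma> q] by (simp add: indep_of_def F_def)
  define a where "a = G (\<lambda>_. 0)"
  define a' where "a' = a(j := a j + 1)"
  have crit: "((\<lambda>s. qform n (\<lambda>i. F a' i + s * v i)) has_field_derivative 0) (at 0)" for v
  proof -
    \<comment> \<open>The line through \<open>F a'\<close> is pulled back by \<open>G\<close>, the
      translation is undone, and \<open>F\<close> is applied. The resulting curve \<delta> starts at
      the origin in the coordinates below \<open>n\<close>, and \<open>shift\<close> keeps the
      values of the form.\<close>
    define \<gamma> where "\<gamma> = (\<lambda>s. G (\<lambda>i. F a' i + s * v i))"
    define \<delta> where "\<delta> = (\<lambda>s. F ((\<gamma> s)(j := \<gamma> s j - 1)))"
    have \<gamma>d: "(\<lambda>s. \<gamma> s i) field_differentiable (at 0)" if "i < n" for i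
      unfolding \<gamma>_def
      by (rule poly_fun_differentiable[OF G[OF that]])
        (auto simp: field_differentiable_def intro!: exI derivative_eq_intros)
    have \<delta>d: "(\<lambda>s. \<delta> s i) field_differentiable (at 0)" if "i < n" for i
      unfolding \<delta>_def
    proof (rule poly_fun_differentiable[OF F[OF that]])
      fix l assume "l < n"
      then show "(\<lambda>s. ((\<gamma> s)(j := \<gamma> s j - 1)) l) field_differentiable (at 0)"
        using \<gamma>d[of l] by (cases "l = j") (auto intro: field_differentiable_diff)
    qed
    have \<delta>0: "\<delta> 0 i = 0" if i: "i < n" for i
    proof -
      have "((\<gamma> 0)(j := \<gamma> 0 j - 1)) l = a l" if "l < n" for l
        using GF[OF that, of a'] GF[OF j, of a'] by (simp add: \<gamma>_def a'_def)
      then have "\<delta> 0 i = F a i"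
        using poly_fun_cong[OF F[OF i], of "(\<gamma> 0)(j := \<gamma> 0 j - 1)" a] by (simp add: \<delta>_def)
      then show ?thesis using FG[OF i] by (simp add: a_def)
    qed
    have "qform n (\<lambda>i. F a' i + s * v i) = qform n (\<delta> s)" for s
    proof -
      have "qform n (\<lambda>i. F a' i + s * v i) = qform n (F (\<gamma> s))"
        by (rule poly_fun_cong[OF q]) (simp add: \<gamma>_def FG)
      also have "\<dots> = qform n (\<delta> s)"
        by (simp add: \<delta>_def shift)
      finally show ?thesis .
    qed
    moreover obtain d where "\<And>i. i < n \<Longrightarrow> ((\<lambda>s. \<delta> s i) has_field_derivative d i) (at 0)"
      using \<delta>d unfolding field_differentiable_def by metis
    from qform_has_derivative[OF n this]
    have "((\<lambda>s. qform n (\<delta> s)) has_field_derivative 0) (at 0)"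
      using \<delta>0 n by simp
    ultimately show ?thesis by simp
  qed
  \<comment> \<open>Both \<open>F a\<close> and \<open>F a'\<close> are the origin in the
    coordinates below \<open>n\<close>, so \<open>G\<close> cannot separate \<open>a\<close> from
    \<open>a'\<close>.\<close>
  have "a' j = G (F a') j" using GF[OF j] by simp
  also have "\<dots> = a j"
    unfolding a_def by (rule poly_fun_cong[OF G[OF j]]) (rule qform_critical_point[OF n crit])
  finally show False by (simp add: a'_def)
qed

section \<open>The two varieties\<close>

lemma qform_variety_not_cylinder:
  assumes n: "2 \<le> n"
  shows "\<not> is_cylinder n [\<lambda>x. x 0 * qform n x - 1]"
proof
  let ?p = "\<lambda>x. x 0 * qform n x - 1"
  let ?j = "n - 1"
  assume "is_cylinder n [?p]"
  then obtain qs \<sigma> where qs: "set qs \<subseteq> poly_fun (n - 1)" and \<sigma>: "poly_aut n \<sigma>"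
    and im: "\<sigma> ` poly_ideal n [?p] = poly_ideal n qs"
    unfolding is_cylinder_def equivalent_def by blast
  have q: "qform n \<in> poly_fun n" using n by (simp add: qform_poly_fun)
  have x0: "(\<lambda>x. x 0) \<in> poly_fun n" using n by (intro poly_fun.var) simp
  have p: "?p \<in> poly_fun n" by (intro poly_fun_intros q x0)
  have hom: "\<sigma> (\<lambda>x. a x * b x) = (\<lambda>x. \<sigma> a x * \<sigma> b x)"
    if "a \<in> poly_fun n" "b \<in> poly_fun n" for a b
    using that \<sigma> by (simp add: poly_aut_def)
  have inj: "a = b" if "\<sigma> a = \<sigma> b" "a \<in> poly_fun n" "b \<in> poly_fun n" for a b
    using that \<sigma> by (auto simp: poly_aut_def bij_betw_def inj_on_def)
  have const: "\<sigma> (\<lambda>_. c) = (\<lambda>_. c)" for c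
    using \<sigma> by (simp add: poly_aut_def)
  have nonzero: "\<exists>x. \<sigma> a x \<noteq> 0" if "a \<in> poly_fun n" "a x \<noteq> 0" for a x
    using inj[of a "\<lambda>_. 0"] that by (auto simp: const poly_fun.const)
  \<comment> \<open>A nonzero generator exists because the image ideal contains
    \<open>\<sigma> ?p\<close>, and \<open>?p\<close> is -1 at the origin. It is a multiple of
    \<open>\<sigma> ?p\<close> free of the last variable.\<close>
  have "\<exists>q\<in>set qs. \<exists>y. q y \<noteq> 0"
  proof (rule ccontr)
    assume "\<not> ?thesis"
    then have "g = (\<lambda>_. 0)" if "g \<in> poly_ideal n qs" for g
      using that unfolding poly_ideal_def by (auto intro!: sum.neutral)
    moreover have "\<sigma> ?p \<in> poly_ideal n qs"
      unfolding im[symmetric] by (intro imageI poly_ideal_generator) simp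
    ultimately have "\<sigma> ?p = (\<lambda>_. 0)" by blast
    then show False
      using nonzero[OF p, of "\<lambda>_. 0"] by simp
  qed
  then obtain r y where r: "r \<in> set qs" "r y \<noteq> 0" by blast
  then obtain b where b: "b \<in> poly_fun n" "r = \<sigma> (\<lambda>x. b x * ?p x)"
    using im poly_ideal_generator[of r qs n] by (auto elim!: poly_ideal_singletonE)
  have r_eq: "r = (\<lambda>x. \<sigma> ?p x * \<sigma> b x)"
    using b(2) hom[OF b(1) p] by (simp add: mult.commute)
  have "indep_of ?j r"
    using qs r(1) by (auto intro: poly_fun_indep_of)
  then have "indep_of ?j (\<sigma> ?p)"
    using r(2) unfolding r_eq
    by (intro indep_of_factor[OF poly_aut_closed[OF \<sigma> p] poly_aut_closed[OF \<sigma> b(1)]])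
  moreover have xq: "\<sigma> (\<lambda>x. x 0 * qform n x) = (\<lambda>x. \<sigma> (qform n) x * \<sigma> (\<lambda>x. x 0) x)"
    using hom[OF x0 q] by (simp add: mult.commute)
  \<comment> \<open>Constants are fixed, so independence passes from \<open>\<sigma> ?p\<close> to a
    product having \<open>\<sigma> (qform n)\<close> as a factor.\<close>
  moreover have "\<sigma> ?p x = \<sigma> (\<lambda>x. x 0 * qform n x) x - 1" for x
    using poly_aut_apply[OF \<sigma> p, of x] poly_aut_apply[OF \<sigma> poly_fun.mult[OF x0 q], of x] by simp
  ultimately have ind: "indep_of ?j (\<lambda>x. \<sigma> (qform n) x * \<sigma> (\<lambda>x. x 0) x)"
    by (simp add: indep_of_def)
  have "qform n (\<lambda>i. if i < 2 then 1 else 0) = 1"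
    by (simp add: qform_def sqsum_def)
  then obtain z where "\<sigma> (\<lambda>x. x 0 * qform n x) z \<noteq> 0"
    using nonzero[OF poly_fun.mult[OF x0 q], of "\<lambda>i. if i < 2 then 1 else 0"] by auto
  then have "indep_of ?j (\<sigma> (qform n))"
    unfolding xq by (intro indep_of_factor[OF poly_aut_closed[OF \<sigma> q] poly_aut_closed[OF \<sigma> x0] ind])
  then show False
    using poly_aut_qform_not_indep[OF n _ \<sigma>, of ?j] n by simp
qed

text \<open>Modulo \<open>x n\<close>, the map \<open>G\<close> puts \<open>f\<close> in place of
  \<open>x 1\<close>, turning \<open>x 0 * x 1 - 1\<close> into \<open>x 0 * f - 1\<close>. Its
  coordinate \<open>n\<close> becomes \<open>x 1 - f * (f - Q) = x 1 * (1 - x 0 * f)\<close>, which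
  lies in the ideal.\<close>

lemma qform_variety_equivalent:
  assumes n: "2 \<le> n"
  shows "equivalent (2 * n) (embed2 n [\<lambda>x. x 0 * qform n x - 1]) (embed2 n [\<lambda>x. x 0 * x 1 - 1])"
proof -
  let ?p = "\<lambda>x. x 0 * qform n x - 1" and ?q = "\<lambda>x::nat \<Rightarrow> complex. x 0 * x 1 - 1"
  let ?t = "\<lambda>x::nat \<Rightarrow> complex. x n"
  let ?Q = "sqsum n" and ?f = "qform n"
  let ?I = "poly_ideal (2 * n) (embed2 n [?p])" and ?J = "poly_ideal (2 * n) (embed2 n [?q])"
  text \<open>\<open>G\<close> is composed of \<open>x\<^sub>n \<mapsto> x\<^sub>n + f\<close>, \<open>x\<^sub>1 \<mapsto> x\<^sub>1 - x\<^sub>n (x\<^sub>n - Q)\<close> and the swap of \<open>x\<^sub>1\<close> and \<open>x\<^sub>n\<close>.\<close>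
  define F where "F = (\<lambda>x. x(1 := x n + x 1 * (x 1 - ?Q x),
    n := x 1 - x 0 * (x n + x 1 * (x 1 - ?Q x)) - ?Q x))"
  define G where "G = (\<lambda>x. x(1 := x n + ?f x, n := x 1 - (x n + ?f x) * (x n + ?f x - ?Q x)))"
  have Q_upd: "?Q (x(1 := a, n := b)) = ?Q x" for x a b
    unfolding sqsum_def by (intro sum.cong) auto
  have F_simps: "F x 0 = x 0" "F x (Suc 0) = x n + x 1 * (x 1 - ?Q x)"
    "F x n = x 1 - x 0 * (x n + x 1 * (x 1 - ?Q x)) - ?Q x"
    "i > n \<Longrightarrow> F x i = x i" "?Q (F x) = ?Q x" for x i
    using n unfolding F_def Q_upd by auto
  have G_simps: "G x 0 = x 0" "G x (Suc 0) = x n + ?f x"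
    "G x n = x 1 - (x n + ?f x) * (x n + ?f x - ?Q x)"
    "i > n \<Longrightarrow> G x i = x i" "?Q (G x) = ?Q x" for x i
    using n unfolding G_def Q_upd by auto
  have other: "F x i = x i" "G x i = x i" if "i \<noteq> 1" "i \<noteq> n" for x i
    using that by (auto simp: F_def G_def)
  note pf = poly_fun_intros sqsum_poly_fun[of n "2 * n"] qform_poly_fun[of n "2 * n"]
  have F: "(\<lambda>x. F x i) \<in> poly_fun (2 * n)" if "i < 2 * n" for i
  proof -
    consider "i = 1" | "i = n" | "i \<noteq> 1" "i \<noteq> n" by blast
    then show ?thesis
      using n that by cases (auto simp: F_simps other intro!: pf)
  qed
  have G: "(\<lambda>x. G x i) \<in> poly_fun (2 * n)" if "i < 2 * n" for i
  proof -
    consider "i = 1" | "i = n" | "i \<noteq> 1" "i \<noteq> n" by blast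
    then show ?thesis
      using n that by cases (auto simp: G_simps other intro!: pf)
  qed
  have FG: "F (G x) = x" for x
  proof
    fix i
    consider "i = 1" | "i = n" | "i \<noteq> 1" "i \<noteq> n" by blast
    then show "F (G x) i = x i"
      by cases (auto simp: F_simps G_simps other qform_def)
  qed
  have GF: "G (F x) = x" for x
  proof
    fix i
    consider "i = 1" | "i = n" | "i \<noteq> 1" "i \<noteq> n" by blast
    then show "G (F x) i = x i"
      by cases (auto simp: F_simps G_simps other qform_def)
  qed
  have set_embed2: "set (embed2 n [h]) = insert h ((\<lambda>i x. x i) ` {n..<2 * n})" for h
    by (auto simp: embed2_def)
  have gens: "h \<in> poly_fun (2 * n) \<Longrightarrow> set (embed2 n [h]) \<subseteq> poly_fun (2 * n)" for h
    by (auto simp: set_embed2 intro: poly_fun.var)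
  have x_in: "(\<lambda>x. x i) \<in> ?I" "(\<lambda>x. x i) \<in> ?J" if "n \<le> i" "i < 2 * n" for i
    using that by (auto intro!: poly_ideal_generator simp: set_embed2)
  have p_in: "?p \<in> ?I" and q_in: "?q \<in> ?J"
    by (auto intro!: poly_ideal_generator simp: set_embed2)
  have comb: "(\<lambda>x. a x * g x + b x * h x) \<in> poly_ideal m ps"
    if "a \<in> poly_fun m" "b \<in> poly_fun m" "g \<in> poly_ideal m ps" "h \<in> poly_ideal m ps" for a b g h m ps
    using that by (intro poly_ideal_add poly_ideal_mult)
  have Fn: "(\<lambda>x. F x n) \<in> ?J"
  proof -
    have "(\<lambda>x. F x n) = (\<lambda>x. (?Q x - x 1) * ?q x + (- x 0) * ?t x)"
      by (auto simp: F_simps algebra_simps)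
    then show ?thesis
      using n by (simp only:) (intro comb x_in q_in pf, auto)
  qed
  have pF: "(\<lambda>x. ?p (F x)) \<in> ?J"
  proof -
    \<comment> \<open>Since \<open>F\<close> inverts \<open>G\<close>, the form satisfies
      \<open>?f (F x) = x 1 - F x n\<close>.\<close>
    have "(\<lambda>x. ?p (F x)) = (\<lambda>x. 1 * ?q x + (- x 0) * F x n)"
      by (auto simp: F_simps qform_def algebra_simps)
    then show ?thesis
      using n by (simp only:) (intro comb Fn q_in pf, auto)
  qed
  have Gn: "(\<lambda>x. G x n) \<in> ?I"
  proof -
    have "(\<lambda>x. G x n) = (\<lambda>x. (- x 1) * ?p x + (?Q x - x n - 2 * ?f x) * ?t x)"
      by (auto simp: G_simps qform_def algebra_simps)
    then show ?thesis
      using n by (simp only:) (intro comb x_in p_in pf, auto)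
  qed
  have qG: "(\<lambda>x. ?q (G x)) \<in> ?I"
  proof -
    have "(\<lambda>x. ?q (G x)) = (\<lambda>x. 1 * ?p x + x 0 * ?t x)"
      by (auto simp: G_simps algebra_simps)
    then show ?thesis
      using n by (simp only:) (intro comb x_in p_in pf, auto)
  qed
  show ?thesis
  proof (rule equivalentI[of "2 * n" F G])
    show "set (embed2 n [?p]) \<subseteq> poly_fun (2 * n)" "set (embed2 n [?q]) \<subseteq> poly_fun (2 * n)"
      using n by (auto intro!: gens pf)
    show "(\<lambda>x. h (F x)) \<in> ?J" if h: "h \<in> set (embed2 n [?p])" for h
    proof -
      consider "h = ?p" | "h = ?t" | i where "h = (\<lambda>x. x i)" "n < i" "i < 2 * n"
        using h unfolding set_embed2 by (auto simp: le_less)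
      then show ?thesis
        using pF Fn x_in by cases (simp_all add: F_simps(4))
    qed
    show "(\<lambda>x. h (G x)) \<in> ?I" if h: "h \<in> set (embed2 n [?q])" for h
    proof -
      consider "h = ?q" | "h = ?t" | i where "h = (\<lambda>x. x i)" "n < i" "i < 2 * n"
        using h unfolding set_embed2 by (auto simp: le_less)
      then show ?thesis
        using qG Gn x_in by cases (simp_all add: G_simps(4))
    qed
  qed (use F G FG GF in auto)
qed

theorem theorem1p6:
  fixes k n :: nat
  assumes "k \<ge> 1" and "n \<ge> k + 2"
  shows "\<exists>vs us. set vs \<subseteq> poly_fun (n - k) \<and> set us \<subseteq> poly_fun n \<and>
           \<not> is_cylinder n us \<and> equivalent (2 * n) (embed2 n us) (embed2 n vs)"
proof (intro exI conjI)
  have n: "2 \<le> n" using assms by simp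
  \<comment> \<open>As \<open>n - k\<close> is at least 2, both coordinates are available; the
    product with \<open>C^k\<close> has the same equation.\<close>
  show "set [\<lambda>x. x 0 * x 1 - 1] \<subseteq> poly_fun (n - k)"
    using assms by (auto intro!: poly_fun_intros)
  show "set [\<lambda>x. x 0 * qform n x - 1] \<subseteq> poly_fun n"
    using n by (auto intro!: poly_fun_intros qform_poly_fun)
  show "\<not> is_cylinder n [\<lambda>x. x 0 * qform n x - 1]"
    using n by (rule qform_variety_not_cylinder)
  show "equivalent (2 * n) (embed2 n [\<lambda>x. x 0 * qform n x - 1]) (embed2 n [\<lambda>x. x 0 * x 1 - 1])"
    using n by (rule qform_variety_equivalent)
qed

end
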